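(* Let $\pi$ be a probability measure on $\mathsf{E}=\mathbb{R}^d$ with a positive density with respect to Lebesgue measure. Let $\nu\gg\pi$ be a $\sigma$-finite measure on $\mathsf{E}$, let $Q$ be a $\nu$-reversible Markov kernel, let $P$ be the $\pi$-reversible Metropolis kernel with proposal $Q$, and let $\alpha_0:=\inf_{x\in\mathsf{E}}\alpha(x)$. Then $$\|P(x,\cdot)-P(y,\cdot)\|_{\mathrm{TV}}\le\|Q(x,\cdot)-Q(y,\cdot)\|_{\mathrm{TV}}+1-\alpha_0,\qquad x,y\in\mathsf{E}.$$
   Context: With $\varpi=\mathrm{d}\pi/\mathrm{d}\nu$, the Metropolis kernel with proposal $Q$ is $P(x,A)=\int_AQ(x,\mathrm{d}y)\,\alpha(x,y)+\mathbf{1}_A(x)\,(1-\alpha(x))$, where $\alpha(x,y):=\min\left\{1,\frac{\varpi(y)}{\varpi(x)}\right\}$ and $\alpha(x):=\int_{\mathsf{E}}Q(x,\mathrm{d}y)\,\alpha(x,y)$. (Convention: $\alpha(x,y)=1$ if $\varpi(x)=0$.) $\|\mu-\mu'\|_{\mathrm{TV}}=\sup_A|\mu(A)-\mu'(A)|$. *)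

theory Defs
  imports "HOL-Probability.Probability"
begin

text \<open>
  A Markov kernel on a measurable space \<open>M\<close> is an element of \<open>M \<rightarrow>\<^sub>M prob_algebra M\<close>.
  The identity below says that \<open>\<nu>(dx) K(x,dy) = \<nu>(dy) K(y,dx)\<close> on measurable rectangles. It is stated
  with the nonnegative integral because \<open>\<nu>\<close> may be infinite.
\<close>

definition reversible :: "'a measure \<Rightarrow> ('a \<Rightarrow> 'a measure) \<Rightarrow> bool" where
  "reversible \<nu> K \<longleftrightarrow>
     (\<forall>A\<in>sets \<nu>. \<forall>B\<in>sets \<nu>.
        (\<integral>\<^sup>+x\<in>A. emeasure (K x) B \<partial>\<nu>) = (\<integral>\<^sup>+x\<in>B. emeasure (K x) A \<partial>\<nu>))"

definition accept :: "('a \<Rightarrow> real) \<Rightarrow> 'a \<Rightarrow> 'a \<Rightarrow> real" where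
  "accept w x y = (if w x = 0 then 1 else min 1 (w y / w x))"

definition accept_prob :: "('a \<Rightarrow> real) \<Rightarrow> ('a \<Rightarrow> 'a measure) \<Rightarrow> 'a \<Rightarrow> real" where
  "accept_prob w Q x = (\<integral>y. accept w x y \<partial>Q x)"

text \<open>
  \<open>measure_of\<close> returns the zero measure unless the given set function is countably additive; the lemma
  \<open>emeasure_metropolis\<close> below shows that it is.
\<close>

definition metropolis :: "('a \<Rightarrow> real) \<Rightarrow> ('a \<Rightarrow> 'a measure) \<Rightarrow> 'a \<Rightarrow> 'a measure" where
  "metropolis w Q x = measure_of (space (Q x)) (sets (Q x))
     (\<lambda>A. (\<integral>\<^sup>+y\<in>A. ennreal (accept w x y) \<partial>Q x) + indicator A x * ennreal (1 - accept_prob w Q x))"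

text \<open>Used only for finite measures with the same \<open>\<sigma>\<close>-algebra, so that the real supremum is bounded.\<close>

definition tv_dist :: "'a measure \<Rightarrow> 'a measure \<Rightarrow> real" where
  "tv_dist M N = (SUP A\<in>sets M. \<bar>measure M A - measure N A\<bar>)"

lemma space_metropolis [simp]: "space (metropolis w Q x) = space (Q x)"
  and sets_metropolis [simp]: "sets (metropolis w Q x) = sets (Q x)"
  by (simp_all add: metropolis_def)

lemma measurable_accept [measurable]:
  assumes [measurable]: "w \<in> borel_measurable M"
  shows "accept w x \<in> borel_measurable M"
  unfolding accept_def by measurable

lemma accept_nonneg: "(\<And>z. 0 \<le> w z) \<Longrightarrow> 0 \<le> accept w x y"
  and accept_le_1: "accept w x y \<le> 1"
  by (auto simp: accept_def)

lemma emeasure_metropolis: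
  assumes w: "w \<in> borel_measurable (Q x)" and A: "A \<in> sets (Q x)"
  shows "emeasure (metropolis w Q x) A =
    (\<integral>\<^sup>+y\<in>A. ennreal (accept w x y) \<partial>Q x) + indicator A x * ennreal (1 - accept_prob w Q x)"
proof (rule emeasure_measure_of[OF metropolis_def])
  let ?c = "ennreal (1 - accept_prob w Q x)"
  let ?f = "\<lambda>A. (\<integral>\<^sup>+y\<in>A. ennreal (accept w x y) \<partial>Q x) + indicator A x * ?c"
  note [measurable] = w
  show "sets (Q x) \<subseteq> Pow (space (Q x))"
    by (rule sets.space_closed)
  show "positive (sets (metropolis w Q x)) ?f"
    by (simp add: positive_def)
  show "countably_additive (sets (metropolis w Q x)) ?f"
  proof (rule countably_additiveI)
    fix F :: "nat \<Rightarrow> 'a set"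
    assume F: "range F \<subseteq> sets (metropolis w Q x)" and disj: "disjoint_family F"
    have "(\<Sum>i. \<integral>\<^sup>+y\<in>F i. ennreal (accept w x y) \<partial>Q x)
        = (\<integral>\<^sup>+y\<in>(\<Union>i. F i). ennreal (accept w x y) \<partial>Q x)"
    proof -
      have "(\<Sum>i. \<integral>\<^sup>+y\<in>F i. ennreal (accept w x y) \<partial>Q x)
          = (\<Sum>i. emeasure (density (Q x) (\<lambda>y. ennreal (accept w x y))) (F i))"
        using F by (intro suminf_cong) (subst emeasure_density; force)
      also have "\<dots> = emeasure (density (Q x) (\<lambda>y. ennreal (accept w x y))) (\<Union>i. F i)"
        using F disj by (intro suminf_emeasure) auto
      also have "\<dots> = (\<integral>\<^sup>+y\<in>(\<Union>i. F i). ennreal (accept w x y) \<partial>Q x)"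
        using F by (subst emeasure_density) auto
      finally show ?thesis .
    qed
    moreover have "(\<Sum>i. indicator (F i) x * ?c) = indicator (\<Union>i. F i) x * ?c"
      using suminf_indicator[OF disj, of x] by simp
    ultimately show "(\<Sum>i. ?f (F i)) = ?f (\<Union>i. F i)"
      by (subst suminf_add[symmetric]) simp_all
  qed
  show "A \<in> sets (metropolis w Q x)"
    using A by simp
qed

lemma prob_space_metropolis:
  assumes "prob_space (Q x)" "x \<in> space (Q x)" "w \<in> borel_measurable (Q x)" "\<And>z. 0 \<le> w z"
  shows "prob_space (metropolis w Q x)"
proof -
  interpret prob_space "Q x" by fact
  note [measurable] = assms(3)
  have int: "integrable (Q x) (accept w x)"
    by (rule integrable_const_bound[of _ 1]) (auto simp: accept_nonneg accept_le_1 assms(4))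
  have le: "accept_prob w Q x \<le> 1"
    unfolding accept_prob_def by (intro integral_le_const int) (auto simp: accept_le_1)
  have ge: "0 \<le> accept_prob w Q x"
    unfolding accept_prob_def by (intro integral_nonneg_AE) (auto simp: accept_nonneg assms(4))
  have "(\<integral>\<^sup>+y\<in>space (Q x). ennreal (accept w x y) \<partial>Q x) = (\<integral>\<^sup>+y. ennreal (accept w x y) \<partial>Q x)"
    by (intro nn_integral_cong) simp
  also have "\<dots> = ennreal (accept_prob w Q x)"
    unfolding accept_prob_def by (intro nn_integral_eq_integral int) (auto simp: accept_nonneg assms(4))
  finally have "emeasure (metropolis w Q x) (space (Q x)) = 1"
    using le ge assms(2,3) by (simp add: emeasure_metropolis flip: ennreal_plus)
  then show ?thesis
    by (intro prob_spaceI) simp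
qed

lemma bdd_above_tv_dist:
  assumes "finite_measure M" "finite_measure N"
  shows "bdd_above ((\<lambda>A. \<bar>measure M A - measure N A\<bar>) ` S)"
proof (rule bdd_aboveI2)
  fix A
  show "\<bar>measure M A - measure N A\<bar> \<le> measure M (space M) + measure N (space N)"
    using finite_measure.bounded_measure[OF assms(1), of A]
      finite_measure.bounded_measure[OF assms(2), of A]
      measure_nonneg[of M A] measure_nonneg[of N A] by linarith
qed

end

theory Submission
  imports Defs
begin

text \<open>
  Both kernels are probability measures, so (passing to complements) it suffices to bound one of the
  two signed differences, and one may choose which. If \<open>w x \<le> w y\<close> then \<open>accept w y \<le> accept w x\<close>
  pointwise, so in \<open>P y A - P x A\<close> the moving parts differ by at most the integral of
  \<open>indicator A * accept w y\<close>, a function with values in \<open>[0, 1]\<close>, against \<open>Q y - Q x\<close>; only the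
  rejection mass at \<open>y\<close> has to be paid for.
\<close>

text \<open>Restricting both measures to \<open>Y\<close> (as densities \<open>indicator Y\<close>)
  turns domination on the subsets of \<open>Y\<close> into the order \<open>\<le>\<close> on
  measures, in which the nonnegative integral is monotone.\<close>

lemma nn_integral_mono_measure_on:
  assumes sets: "sets M = sets N" and Y: "Y \<in> sets N" and g: "g \<in> borel_measurable N"
    and le: "\<And>X. X \<in> sets N \<Longrightarrow> X \<subseteq> Y \<Longrightarrow> emeasure M X \<le> emeasure N X"
  shows "(\<integral>\<^sup>+z\<in>Y. g z \<partial>M) \<le> (\<integral>\<^sup>+z\<in>Y. g z \<partial>N)"
proof -
  have [measurable]: "Y \<in> sets M" "Y \<in> sets N" "g \<in> borel_measurable M" "g \<in> borel_measurable N"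
    using Y g sets measurable_cong_sets[OF sets refl] by simp_all
  have "density M (indicator Y) \<le> density N (indicator Y)"
  proof (rule le_measure[THEN iffD2, rule_format])
    fix A assume "A \<in> sets (density M (indicator Y))"
    then show "emeasure (density M (indicator Y)) A \<le> emeasure (density N (indicator Y)) A"
      using Y sets by (simp add: emeasure_restricted le)
  qed (simp add: sets)
  then have "nn_integral (density M (indicator Y)) g \<le> nn_integral (density N (indicator Y)) g"
    by (intro nn_integral_mono_measure) (auto simp: sets)
  then show ?thesis
    by (simp add: nn_integral_density mult.commute)
qed

lemma abs_measure_diff_le_tv_dist:
  assumes "finite_measure M" "finite_measure N" "A \<in> sets M"
  shows "\<bar>measure M A - measure N A\<bar> \<le> tv_dist M N"
  unfolding tv_dist_def
  using assms by (intro cSUP_upper bdd_above_tv_dist)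

text \<open>By the Hahn decomposition, among functions with values in [0, 1] the indicator of the
  set \<open>Y\<close> where \<open>M\<close> dominates \<open>N\<close> makes the difference of
  integrals largest. Its value there, \<open>measure M Y - measure N Y\<close>, is one of the terms
  in the supremum \<open>tv_dist M N\<close>.\<close>

lemma integral_diff_le_tv_dist:
  fixes f :: "'a \<Rightarrow> real"
  assumes M: "finite_measure M" and N: "finite_measure N" and sets: "sets N = sets M"
    and f [measurable]: "f \<in> borel_measurable M"
    and f0: "\<And>z. 0 \<le> f z" and f1: "\<And>z. f z \<le> 1"
  shows "(\<integral>z. f z \<partial>M) - (\<integral>z. f z \<partial>N) \<le> tv_dist M N"
proof -
  obtain Y where Y: "Y \<in> sets M"
    and NM: "\<And>X. X \<in> sets M \<Longrightarrow> X \<subseteq> Y \<Longrightarrow> emeasure N X \<le> emeasure M X"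
    and MN: "\<And>X. X \<in> sets M \<Longrightarrow> X \<inter> Y = {} \<Longrightarrow> emeasure M X \<le> emeasure N X"
    using finite_unsigned_Hahn_decomposition[OF M N sets] by blast
  note [measurable] = Y
  have YN [measurable]: "Y \<in> sets N"
    using Y sets by simp
  have fN [measurable]: "f \<in> borel_measurable N"
    using f sets by (simp cong: measurable_cong_sets)
  \<comment> \<open>Domination is compared through nonnegative integrals, while differences need
    real ones; for integrands between 0 and 1 on a finite measure the two agree.\<close>
  have nn: "(\<integral>\<^sup>+z\<in>B. ennreal (g z) \<partial>L) = ennreal (\<integral>z. g z * indicator B z \<partial>L)"
    and int: "integrable L (\<lambda>z. g z * indicator B z :: real)"
    if [measurable]: "B \<in> sets L" "g \<in> borel_measurable L" and L: "finite_measure L"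
      and g: "\<And>z. 0 \<le> g z" "\<And>z. g z \<le> 1"
    for B g and L :: "'a measure"
  proof -
    interpret L: finite_measure L by fact
    show int: "integrable L (\<lambda>z. g z * indicator B z :: real)"
      by (rule L.integrable_const_bound[of _ 1]) (auto simp: g indicator_def)
    show "(\<integral>\<^sup>+z\<in>B. ennreal (g z) \<partial>L) = ennreal (\<integral>z. g z * indicator B z \<partial>L)"
      using int g by (subst nn_integral_eq_integral[symmetric])
        (auto intro!: nn_integral_cong simp: indicator_def)
  qed
  let ?Z = "space M - Y"
  \<comment> \<open>Off \<open>Y\<close> the measure \<open>N\<close> dominates, so this part
    contributes at most 0 to the difference.\<close>
  have out: "(\<integral>z. f z * indicator ?Z z \<partial>M) \<le> (\<integral>z. f z * indicator ?Z z \<partial>N)"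
  proof -
    have "(\<integral>\<^sup>+z\<in>?Z. ennreal (f z) \<partial>M) \<le> (\<integral>\<^sup>+z\<in>?Z. ennreal (f z) \<partial>N)"
      by (rule nn_integral_mono_measure_on) (auto simp: sets intro!: MN dest: sets.sets_into_space)
    then show ?thesis
      using f0 f1 sets by (simp add: nn M N integral_nonneg ennreal_le_iff)
  qed
  \<comment> \<open>Monotonicity is applied to \<open>1 - f\<close> rather than \<open>f\<close>: on
    \<open>Y\<close> the gap between \<open>f\<close> and the maximal choice 1 costs more under
    \<open>M\<close> than under \<open>N\<close>.\<close>
  have "(\<integral>z. (1 - f z) * indicator Y z \<partial>N) \<le> (\<integral>z. (1 - f z) * indicator Y z \<partial>M)"
  proof -
    have "(\<integral>\<^sup>+z\<in>Y. ennreal (1 - f z) \<partial>N) \<le> (\<integral>\<^sup>+z\<in>Y. ennreal (1 - f z) \<partial>M)"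
      by (rule nn_integral_mono_measure_on) (auto simp: sets intro!: NM)
    then show ?thesis
      using f0 f1 by (simp add: nn M N integral_nonneg ennreal_le_iff)
  qed
  moreover have "(\<integral>z. (1 - f z) * indicator Y z \<partial>L)
      = measure L Y - (\<integral>z. f z * indicator Y z \<partial>L)"
    if "finite_measure L" "sets L = sets M" for L
  proof -
    interpret L: finite_measure L by fact
    have [measurable]: "f \<in> borel_measurable L" "Y \<in> sets L"
      using that f Y by (simp_all cong: measurable_cong_sets)
    have "(\<integral>z. (1 - f z) * indicator Y z \<partial>L)
        = (\<integral>z. indicator Y z - f z * indicator Y z \<partial>L)"
      by (simp add: left_diff_distrib)
    also have "\<dots> = (\<integral>z. indicator Y z \<partial>L) - (\<integral>z. f z * indicator Y z \<partial>L)"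
      using int[of Y L f] f0 f1 that
      by (intro Bochner_Integration.integral_diff) (auto simp: L.emeasure_eq_measure)
    finally show ?thesis by simp
  qed
  ultimately have inn: "(\<integral>z. f z * indicator Y z \<partial>M) - (\<integral>z. f z * indicator Y z \<partial>N)
      \<le> measure M Y - measure N Y"
    using M N sets by simp
  have split: "(\<integral>z. f z \<partial>L) = (\<integral>z. f z * indicator Y z \<partial>L) + (\<integral>z. f z * indicator ?Z z \<partial>L)"
    if L: "finite_measure L" "sets L = sets M" for L
  proof -
    have [measurable]: "f \<in> borel_measurable L" "Y \<in> sets L" "?Z \<in> sets L"
      using that f Y by (simp_all cong: measurable_cong_sets)
    have "(\<integral>z. f z \<partial>L) = (\<integral>z. f z * indicator Y z + f z * indicator ?Z z \<partial>L)"
      using sets_eq_imp_space_eq[OF L(2)] by (intro Bochner_Integration.integral_cong) (auto simp: indicator_def)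
    also have "\<dots> = (\<integral>z. f z * indicator Y z \<partial>L) + (\<integral>z. f z * indicator ?Z z \<partial>L)"
      using int f0 f1 L by (intro Bochner_Integration.integral_add) auto
    finally show ?thesis .
  qed
  show ?thesis
    using split[OF M refl] split[OF N sets] out inn abs_measure_diff_le_tv_dist[OF M N Y]
    by linarith
qed

text \<open>The current point enters the acceptance ratio only through the denominator. If
  \<open>w x = 0\<close>, the convention gives \<open>accept w x z = 1\<close>, the largest possible
  value.\<close>

lemma accept_antimono:
  assumes "w x \<le> w y" "\<And>z. 0 \<le> w z"
  shows "accept w y z \<le> accept w x z"
proof (cases "w x = 0")
  case True
  then show ?thesis
    using accept_le_1[of w y z] by (simp add: accept_def[of w x])
next
  case False
  then have "0 < w x" "0 \<le> w z"
    using assms(2)[of x] assms(2)[of z] by auto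
  then have "w z / w y \<le> w z / w x"
    using assms(1) by (intro divide_left_mono) auto
  then show ?thesis
    using assms(1) \<open>0 < w x\<close> by (auto simp: accept_def)
qed

lemma integrable_accept:
  assumes "prob_space (Q x)" "w \<in> borel_measurable (Q x)" "\<And>z. 0 \<le> w z"
  shows "integrable (Q x) (accept w x)"
proof -
  interpret prob_space "Q x" by fact
  note [measurable] = assms(2)
  show ?thesis
    by (rule integrable_const_bound[of _ 1]) (auto simp: accept_nonneg accept_le_1 assms(3))
qed

lemma accept_prob_nonneg: "(\<And>z. 0 \<le> w z) \<Longrightarrow> 0 \<le> accept_prob w Q x"
  unfolding accept_prob_def by (intro Bochner_Integration.integral_nonneg accept_nonneg)

lemma accept_prob_le_1:
  assumes "prob_space (Q x)" "w \<in> borel_measurable (Q x)" "\<And>z. 0 \<le> w z"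
  shows "accept_prob w Q x \<le> 1"
proof -
  interpret prob_space "Q x" by fact
  show ?thesis
    unfolding accept_prob_def
    by (intro integral_le_const integrable_accept assms) (auto simp: accept_le_1)
qed

text \<open>The real-valued form of \<open>emeasure_metropolis\<close>, in which differences can be
  taken. Since \<open>accept_prob w Q x\<close> is at most 1, \<open>ennreal\<close> does not
  truncate the rejection mass.\<close>

lemma measure_metropolis:
  assumes Q: "prob_space (Q x)" and w: "w \<in> borel_measurable (Q x)" "\<And>z. 0 \<le> w z"
    and A: "A \<in> sets (Q x)"
  shows "measure (metropolis w Q x) A =
    (\<integral>z. accept w x z * indicator A z \<partial>Q x) + indicator A x * (1 - accept_prob w Q x)"
proof -
  note [measurable] = w(1) A
  have int: "integrable (Q x) (\<lambda>z. accept w x z * indicator A z)"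
    using integrable_accept[of Q x w, OF Q w] A by (intro integrable_real_mult_indicator)
  have "(\<integral>\<^sup>+z\<in>A. ennreal (accept w x z) \<partial>Q x) = (\<integral>\<^sup>+z. ennreal (accept w x z * indicator A z) \<partial>Q x)"
    by (intro nn_integral_cong) (simp add: indicator_def)
  also have "\<dots> = ennreal (\<integral>z. accept w x z * indicator A z \<partial>Q x)"
    by (intro nn_integral_eq_integral int) (simp add: accept_nonneg w)
  finally have "emeasure (metropolis w Q x) A =
      ennreal ((\<integral>z. accept w x z * indicator A z \<partial>Q x) + indicator A x * (1 - accept_prob w Q x))"
    using accept_prob_le_1[of Q x w, OF Q w] w
    by (simp add: emeasure_metropolis indicator_def integral_nonneg accept_nonneg flip: ennreal_plus)
  then show ?thesis
    using accept_prob_le_1[of Q x w, OF Q w] w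
    by (intro measure_eq_emeasure_eq_ennreal add_nonneg_nonneg Bochner_Integration.integral_nonneg)
      (auto simp: accept_nonneg)
qed

text \<open>The intermediate term is the integral of \<open>accept w y\<close> over \<open>A\<close>
  against \<open>Q x\<close>: first the measure changes from \<open>Q y\<close> to
  \<open>Q x\<close> with the integrand fixed, then the integrand changes with \<open>Q x\<close>
  fixed.\<close>

lemma measure_metropolis_diff_le:
  assumes Qx: "prob_space (Q x)" and Qy: "prob_space (Q y)" and sets: "sets (Q x) = sets (Q y)"
    and w: "w \<in> borel_measurable (Q y)" "\<And>z. 0 \<le> w z"
    and le: "w x \<le> w y" and A: "A \<in> sets (Q y)"
  shows "measure (metropolis w Q y) A - measure (metropolis w Q x) A
       \<le> tv_dist (Q y) (Q x) + (1 - accept_prob w Q y)"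
proof -
  interpret Qx: prob_space "Q x" by fact
  interpret Qy: prob_space "Q y" by fact
  have wx [measurable]: "w \<in> borel_measurable (Q x)" and Ax [measurable]: "A \<in> sets (Q x)"
    using w A sets by (simp_all cong: measurable_cong_sets)
  note [measurable] = w(1) A
  let ?f = "\<lambda>u z. accept w u z * indicator A z"
  have "(\<integral>z. ?f y z \<partial>Q y) - (\<integral>z. ?f y z \<partial>Q x) \<le> tv_dist (Q y) (Q x)"
    by (rule integral_diff_le_tv_dist)
      (auto simp: sets accept_nonneg accept_le_1 w indicator_def
        Qx.finite_measure_axioms Qy.finite_measure_axioms)
  \<comment> \<open>The only use of \<open>w x \<le> w y\<close>: changing the integrand costs
    nothing.\<close>
  moreover have "(\<integral>z. ?f y z \<partial>Q x) \<le> (\<integral>z. ?f x z \<partial>Q x)"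
    by (intro integral_mono Qx.integrable_const_bound[of _ 1])
      (auto simp: accept_nonneg accept_le_1 accept_antimono le w indicator_def)
  \<comment> \<open>The rejection mass at \<open>y\<close> is charged in full; the one at
    \<open>x\<close> enters with a negative sign and is dropped.\<close>
  moreover have "indicator A y * (1 - accept_prob w Q y) \<le> 1 - accept_prob w Q y"
    using accept_prob_le_1[of Q y w, OF Qy w] by (simp add: indicator_def)
  moreover have "0 \<le> indicator A x * (1 - accept_prob w Q x)"
    using accept_prob_le_1[of Q x w, OF Qx wx w(2)] by (simp add: indicator_def)
  ultimately show ?thesis
    using measure_metropolis[of Q x w, OF Qx wx w(2) Ax] measure_metropolis[of Q y w, OF Qy w A] by linarith
qed

lemma tv_dist_commute: "sets M = sets N \<Longrightarrow> tv_dist M N = tv_dist N M"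
  by (simp add: tv_dist_def abs_minus_commute)

text \<open>For probability measures, passing to the complement of \<open>A\<close> flips the sign
  of the difference, so a one-sided bound over all \<open>A\<close> also bounds the absolute
  value.\<close>

lemma tv_dist_le:
  assumes M: "prob_space M" and N: "prob_space N" and sets: "sets M = sets N"
    and le: "\<And>A. A \<in> sets M \<Longrightarrow> measure M A - measure N A \<le> c"
  shows "tv_dist M N \<le> c"
  unfolding tv_dist_def
proof (rule cSUP_least)
  interpret M: prob_space M by fact
  interpret N: prob_space N by fact
  fix A assume A: "A \<in> sets M"
  have "measure M (space M - A) = 1 - measure M A" "measure N (space M - A) = 1 - measure N A"
    using A sets sets_eq_imp_space_eq[OF sets] M.prob_compl N.prob_compl by auto
  then show "\<bar>measure M A - measure N A\<bar> \<le> c"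
    using le[OF A] le[of "space M - A"] A by auto
qed auto

lemma tv_dist_metropolis_le:
  assumes Q: "\<And>z. prob_space (Q z)" "\<And>z. sets (Q z) = sets M" and M: "space M = UNIV"
    and w: "w \<in> borel_measurable M" "\<And>z. 0 \<le> w z"
  shows "tv_dist (metropolis w Q x) (metropolis w Q y)
       \<le> tv_dist (Q x) (Q y) + 1 - (INF z. accept_prob w Q z)"
proof -
  have wQ: "w \<in> borel_measurable (Q z)" for z
    using w Q by (simp cong: measurable_cong_sets)
  have P: "prob_space (metropolis w Q z)" for z
    using Q w wQ M sets_eq_imp_space_eq[OF Q(2)] by (intro prob_space_metropolis) auto
  \<comment> \<open>The lower bound 0 makes the real infimum a genuine lower bound of the acceptance
    probabilities.\<close>
  have INF: "(INF z. accept_prob w Q z) \<le> accept_prob w Q z" for z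
    by (intro cINF_lower bdd_belowI2[of _ 0]) (auto intro: accept_prob_nonneg w)
  \<comment> \<open>The rejection mass is paid at \<open>v\<close>, the point with the larger
    density, and is at most one minus the infimum.\<close>
  have *: "tv_dist (metropolis w Q v) (metropolis w Q u)
      \<le> tv_dist (Q v) (Q u) + 1 - (INF z. accept_prob w Q z)" if "w u \<le> w v" for u v
  proof (rule tv_dist_le[OF P P])
    fix A assume "A \<in> sets (metropolis w Q v)"
    then show "measure (metropolis w Q v) A - measure (metropolis w Q u) A
        \<le> tv_dist (Q v) (Q u) + 1 - (INF z. accept_prob w Q z)"
      using measure_metropolis_diff_le[of Q u v w A] Q wQ w(2) that INF[of v]
      by simp
  qed (simp add: Q)
  show ?thesis
  \<comment> \<open>The order on the reals is total, so one of the two orientations applies;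
    symmetry of \<open>tv_dist\<close> reduces both to the stated one.\<close>
  proof (cases "w y \<le> w x")
    case False
    then show ?thesis
      using *[of x y] by (simp add: tv_dist_commute[of "Q x"] tv_dist_commute[of "metropolis w Q x"] Q)
  qed (rule *)
qed

theorem lemma19:
  fixes \<pi> \<nu> :: "(real ^ 'd) measure"
    and p w :: "real ^ 'd \<Rightarrow> real"
    and Q :: "real ^ 'd \<Rightarrow> (real ^ 'd) measure"
    and x y :: "real ^ 'd"
  assumes "prob_space \<pi>"
    and "p \<in> borel_measurable borel"
    and "\<And>z. 0 < p z"
    and "\<pi> = density lborel (\<lambda>z. ennreal (p z))"
    and "sets \<nu> = sets borel"
    and "sigma_finite_measure \<nu>"
    and "absolutely_continuous \<nu> \<pi>"
    and "w \<in> borel_measurable borel"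
    and "\<And>z. 0 \<le> w z"
    and "AE z in \<nu>. ennreal (w z) = RN_deriv \<nu> \<pi> z"
    and "Q \<in> borel \<rightarrow>\<^sub>M prob_algebra borel"
    and "reversible \<nu> Q"
  shows "tv_dist (metropolis w Q x) (metropolis w Q y)
       \<le> tv_dist (Q x) (Q y) + 1 - (INF z. accept_prob w Q z)"
proof (rule tv_dist_metropolis_le[where M = borel])
  have "Q z \<in> space (prob_algebra borel)" for z
    using measurable_space[OF assms(11)] by simp
  then show "prob_space (Q z)" "sets (Q z) = sets borel" for z
    by (auto simp: space_prob_algebra)
qed (use assms in auto)

end
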